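(* Let $0\le\alpha\le2$ and $0<t<\pi/2$ be fixed, and let $\omega_1,\omega_2,e_1,e_2,e_3$ and $\mu^*_{\min},\mu^*_{\max}$ be the associated quantities defined in the context. (i) If $\alpha\le 1/2$, then $$\Bigl(\tfrac14-\alpha^2\Bigr)e_2-\Bigl(\frac{\pi}{2\omega_1}\Bigr)^2\le\mu^*_{\min},\qquad \mu^*_{\max}\le\Bigl(\tfrac14-\alpha^2\Bigr)e_1+\Bigl(\frac{\pi}{2|\omega_2|}\Bigr)^2 .$$ (ii) If $\alpha\ge 1/2$, then $$\Bigl(\tfrac14-\alpha^2\Bigr)e_3-\Bigl(\frac{\pi}{2\omega_1}\Bigr)^2\le\mu^*_{\min},\qquad \mu^*_{\max}\le\Bigl(\tfrac14-\alpha^2\Bigr)e_3+\Bigl(\frac{\pi}{2|\omega_2|}\Bigr)^2 .$$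
   Context: $\mathbb{D}$ is the open unit disk; $E(z)=\int_0^z \frac{du}{\sqrt{u^4-2(\cos 2t)u^2+1}}$ on $\mathbb{D}$ (branch of the root equal to $1$ at $0$); $\omega_1=E(1)>0$, $\omega_2=E(i)\in i\mathbb{R}_{>0}$ (integrals along straight segments), $\omega_3=\omega_1+\omega_2$; $R=E(\mathbb{D})=\{w:|\operatorname{Re}w|<\omega_1,\ |\operatorname{Im}w|<|\omega_2|\}$. $\wp$ is the Weierstrass function with primitive periods $2\omega_1,2\omega_2$, and $e_i=\wp(\omega_i)$; these are real with $e_2<e_3<e_1$. For $\mu\in\mathbb{R}$, let $g=g_{\alpha,t,\mu}$ be the meromorphic function on $R$ with Schwarzian derivative $\mathcal{S}_g(\zeta)=(g''/g')'-\frac12(g''/g')^2=\frac{1-4\alpha^2}{2}\wp(\zeta+\omega_3)-2\mu$, normalized by $g(0)=0$, $g'(0)=1$, $g''(0)=0$. Equivalently $g=\eta_2/\eta_1$, where $\eta_1,\eta_2$ solve $\eta''+\bigl((\frac14-\alpha^2)\wp(\zeta+\omega_3)-\mu\bigr)\eta=0$ with $(\eta(0),\eta'(0))=(1,0)$ and $(0,1)$ respectively. $\mu^*_{\min}$ and $\mu^*_{\max}$ are the endpoints (infimum and supremum) of the interval of those $\mu\in\mathbb{R}$ for which $g_{\alpha,t,\mu}$ has no poles in $R$. *)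

theory Defs
  imports "HOL-Complex_Analysis.Complex_Analysis" "HOL-Library.Extended_Real"
begin

text \<open>
  On the open unit disk \<open>u ^ 4 - 2 * cos (2 * t) * u\<^sup>2 + 1\<close> is the product of
  \<open>1 - cis (2 * t) * u\<^sup>2\<close> and \<open>1 - cis (- 2 * t) * u\<^sup>2\<close>, both with positive real part. Hence it
  avoids the branch cut of \<^const>\<open>csqrt\<close>, and \<^const>\<open>csqrt\<close> gives the holomorphic branch of the root
  with value 1 at 0. For \<open>0 < t < pi / 2\<close> the polynomial is positive on the closed segments from 0 to
  1 and from 0 to \<open>\<i>\<close>.
\<close>

definition E :: "real \<Rightarrow> complex \<Rightarrow> complex" where
  "E t z = contour_integral (linepath 0 z)
             (\<lambda>u. 1 / csqrt (u ^ 4 - 2 * complex_of_real (cos (2 * t)) * u\<^sup>2 + 1))"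

definition omega1 :: "real \<Rightarrow> complex" where
  "omega1 t = E t 1"

definition omega2 :: "real \<Rightarrow> complex" where
  "omega2 t = E t \<i>"

definition omega3 :: "real \<Rightarrow> complex" where
  "omega3 t = omega1 t + omega2 t"

definition R :: "real \<Rightarrow> complex set" where
  "R t = E t ` ball 0 1"

definition period_lattice :: "complex \<Rightarrow> complex \<Rightarrow> complex set" where
  "period_lattice a b = {of_int m * a + of_int n * b | m n. True}"

text \<open>
  The arguments \<open>a\<close> and \<open>b\<close> are the full periods, not the half-periods. The series
  converges absolutely off the lattice; the values at lattice points are meaningless.
\<close>

definition weierstrass_p :: "complex \<Rightarrow> complex \<Rightarrow> complex \<Rightarrow> complex" where
  "weierstrass_p a b z =
     1 / z\<^sup>2 + (\<Sum>\<^sub>\<infinity>w\<in>period_lattice a b - {0}. 1 / (z - w)\<^sup>2 - 1 / w\<^sup>2)"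

definition wp :: "real \<Rightarrow> complex \<Rightarrow> complex" where
  "wp t = weierstrass_p (2 * omega1 t) (2 * omega2 t)"

text \<open>The values of \<open>wp t\<close> at the three half-periods are real, so \<^const>\<open>Re\<close> only changes the type.\<close>

definition e1 :: "real \<Rightarrow> real" where
  "e1 t = Re (wp t (omega1 t))"

definition e2 :: "real \<Rightarrow> real" where
  "e2 t = Re (wp t (omega2 t))"

definition e3 :: "real \<Rightarrow> real" where
  "e3 t = Re (wp t (omega3 t))"

definition schwarzian :: "(complex \<Rightarrow> complex) \<Rightarrow> complex \<Rightarrow> complex" where
  "schwarzian g z =
     deriv (\<lambda>w. deriv (deriv g) w / deriv g w) z - 1 / 2 * (deriv (deriv g) z / deriv g z)\<^sup>2"

text \<open>
  \<open>is_g \<alpha> t \<mu> g\<close> characterises the function \<open>g\<close> with parameters \<open>\<alpha>, t, \<mu>\<close>, which exists and is unique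
  on \<open>R t\<close>. The notion \<open>nicely_meromorphic_on\<close> excludes removable singularities, so \<open>g\<close> is analytic
  at each point of \<open>R t\<close> that is not a pole. No critical points need to be excluded in the Schwarzian
  equation: near a zero of the derivative of \<open>g\<close> the Schwarzian derivative is unbounded, whereas the
  right-hand side is holomorphic on \<open>R t\<close>. Analyticity at 0 is required separately because \<^const>\<open>deriv\<close>
  is unspecified at a pole.
\<close>

definition is_g :: "real \<Rightarrow> real \<Rightarrow> real \<Rightarrow> (complex \<Rightarrow> complex) \<Rightarrow> bool" where
  "is_g \<alpha> t \<mu> g \<longleftrightarrow>
     g nicely_meromorphic_on R t \<and>
     (\<forall>z\<in>R t. \<not> is_pole g z \<longrightarrow>
        schwarzian g z =
          complex_of_real ((1 - 4 * \<alpha>\<^sup>2) / 2) * wp t (z + omega3 t) - 2 * complex_of_real \<mu>) \<and>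
     g analytic_on {0} \<and> g 0 = 0 \<and> deriv g 0 = 1 \<and> deriv (deriv g) 0 = 0"

definition pole_free_params :: "real \<Rightarrow> real \<Rightarrow> real set" where
  "pole_free_params \<alpha> t = {\<mu>. \<exists>g. is_g \<alpha> t \<mu> g \<and> (\<forall>z\<in>R t. \<not> is_pole g z)}"

text \<open>Infimum and supremum are taken in \<^typ>\<open>ereal\<close>, where they exist for every set of reals.\<close>

definition mu_min :: "real \<Rightarrow> real \<Rightarrow> ereal" where
  "mu_min \<alpha> t = (INF \<mu>\<in>pole_free_params \<alpha> t. ereal \<mu>)"

definition mu_max :: "real \<Rightarrow> real \<Rightarrow> ereal" where
  "mu_max \<alpha> t = (SUP \<mu>\<in>pole_free_params \<alpha> t. ereal \<mu>)"

end

theory Submission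
  imports Defs
begin

text \<open>
  Let \<open>g\<close> be free of poles. On the segments \<open>- s\<close> and \<open>- \<i> * s\<close> from 0 to the boundary of \<open>R t\<close>,
  the function \<open>p = g'' / g'\<close> (derivatives in \<open>s\<close>) solves a Riccati equation \<open>p' = p\<^sup>2 / 2 + 2 * q\<close>
  with \<open>p = 0\<close> at 0, where \<open>q\<close> is plus or minus \<open>(1 / 4 - \<alpha>\<^sup>2) * \<wp> - \<mu>\<close> on a side of a half-period
  rectangle. If \<open>q \<ge> k\<^sup>2\<close> there, then \<open>p \<ge> 2 * k * tan (k * s)\<close> blows up before \<open>pi / (2 * k)\<close>,
  so the segment is at most that long. It remains to bound \<open>\<wp>\<close> on two sides of the rectangle by
  its values at the corners. On a rectangular lattice \<open>\<wp>\<close> is real on the sides, and \<open>Im \<wp> \<le> 0\<close>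
  inside by the maximum principle; the sign of the normal derivative of \<open>Im \<wp>\<close> and the
  Cauchy-Riemann equations then make \<open>\<wp>\<close> monotone along the sides.
\<close>

section \<open>Blow-up for a Riccati equation\<close>

text \<open>Any solution is real, since \<open>(Im p)\<^sup>2 / (cmod \<phi>)\<^sup>2\<close> has derivative 0. As \<open>p \<ge> 0\<close>, \<open>cmod \<phi>\<close> does not
  decrease, so \<open>\<phi>\<close> cannot vanish first.\<close>

lemma riccati_blowup:
  fixes \<phi> \<phi>' :: "real \<Rightarrow> complex" and q :: "real \<Rightarrow> real" and k L :: real
  assumes k: "k > 0" and L: "pi / (2 * k) < L"
    and d\<phi>: "\<And>x. 0 \<le> x \<Longrightarrow> x < L \<Longrightarrow> (\<phi> has_vector_derivative \<phi>' x) (at x)"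
    and dp: "\<And>x. 0 \<le> x \<Longrightarrow> x < L \<Longrightarrow> \<phi> x \<noteq> 0 \<Longrightarrow>
      ((\<lambda>x. \<phi>' x / \<phi> x) has_vector_derivative (\<phi>' x / \<phi> x)\<^sup>2 / 2 + of_real (2 * q x)) (at x)"
    and q: "\<And>x. 0 \<le> x \<Longrightarrow> x < L \<Longrightarrow> k\<^sup>2 \<le> q x"
    and init: "\<phi> 0 \<noteq> 0" "\<phi>' 0 = 0"
  shows False
proof -
  define p where "p = (\<lambda>x. \<phi>' x / \<phi> x)"
  define u where "u = (\<lambda>x. Re (p x))"
  define v where "v = (\<lambda>x. Im (p x))"
  define N where "N = (\<lambda>x. (cmod (\<phi> x))\<^sup>2)"
  have dN: "(N has_field_derivative 2 * u x * N x) (at x)" if x: "0 \<le> x" "x < L" "\<phi> x \<noteq> 0" for x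
  proof -
    have "\<phi>' x = p x * \<phi> x" using x by (simp add: p_def)
    hence eq: "Re (\<phi>' x) = u x * Re (\<phi> x) - v x * Im (\<phi> x)"
      "Im (\<phi>' x) = u x * Im (\<phi> x) + v x * Re (\<phi> x)" by (auto simp: u_def v_def)
    have "((\<lambda>x. Re (\<phi> x)) has_field_derivative Re (\<phi>' x)) (at x)"
      "((\<lambda>x. Im (\<phi> x)) has_field_derivative Im (\<phi>' x)) (at x)"
      using d\<phi>[OF x(1,2)] by (simp_all add: has_vector_derivative_complex_iff)
    from DERIV_add[OF DERIV_power[OF this(1), of 2] DERIV_power[OF this(2), of 2]]
    show ?thesis unfolding N_def cmod_power2
      by (rule DERIV_cong) (simp add: eq, simp add: algebra_simps power2_eq_square)
  qed
  have duv: "(u has_field_derivative ((u x)\<^sup>2 - (v x)\<^sup>2) / 2 + 2 * q x) (at x)"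
    "(v has_field_derivative u x * v x) (at x)" if x: "0 \<le> x" "x < L" "\<phi> x \<noteq> 0" for x
  proof -
    have "(p has_vector_derivative (p x)\<^sup>2 / 2 + of_real (2 * q x)) (at x)"
      using dp[OF x] unfolding p_def by simp
    thus "(u has_field_derivative ((u x)\<^sup>2 - (v x)\<^sup>2) / 2 + 2 * q x) (at x)"
      "(v has_field_derivative u x * v x) (at x)"
      by (simp_all add: has_vector_derivative_complex_iff u_def v_def power2_eq_square mult.commute)
  qed
  have v0: "v y = 0"
    if y: "0 \<le> y" "y < L" and nz: "\<And>x. 0 \<le> x \<Longrightarrow> x \<le> y \<Longrightarrow> \<phi> x \<noteq> 0" for y
  proof -
    have Npos: "N x > 0" if "0 \<le> x" "x \<le> y" for x using nz[OF that] by (simp add: N_def)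
    have der: "((\<lambda>x. (v x)\<^sup>2 / N x) has_field_derivative 0) (at x)" if "0 \<le> x" "x \<le> y" for x
    proof -
      have x: "0 \<le> x" "x < L" "\<phi> x \<noteq> 0" using that y nz by auto
      show ?thesis
        using Npos[OF that]
        by (auto intro!: derivative_eq_intros duv[OF x] dN[OF x] simp: power2_eq_square)
    qed
    have "(v y)\<^sup>2 / N y = (v 0)\<^sup>2 / N 0"
    proof (cases "y = 0")
      case False
      show ?thesis
      proof (rule DERIV_isconst_end[where f = "\<lambda>x. (v x)\<^sup>2 / N x"])
        show "continuous_on {0..y} (\<lambda>x. (v x)\<^sup>2 / N x)"
          using der by (intro continuous_at_imp_continuous_on ballI) (auto dest: DERIV_isCont)
      qed (use False y der in auto)
    qed simp
    thus ?thesis using Npos[of y] y init by (auto simp: v_def p_def)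
  qed
  \<comment> \<open>Comparison with \<open>2 * k * tan (k * x)\<close>, which solves
    \<open>p' = p\<^sup>2 / 2 + 2 * k\<^sup>2\<close>. Under \<open>arctan\<close> it becomes
    monotonicity of \<open>arctan (u x / (2 * k)) - k * x\<close>, which follows from
    \<open>v = 0\<close> and the lower bound on \<open>q\<close>.\<close>
  have atan: "k * y \<le> arctan (u y / (2 * k))"
    if y: "0 \<le> y" "y < L" and nz: "\<And>x. 0 \<le> x \<Longrightarrow> x \<le> y \<Longrightarrow> \<phi> x \<noteq> 0" for y
  proof -
    have "arctan (u 0 / (2 * k)) - k * 0 \<le> arctan (u y / (2 * k)) - k * y"
    proof (rule DERIV_nonneg_imp_nondecreasing[OF y(1)])
      fix x assume x: "0 \<le> x" "x \<le> y"
      have x': "0 \<le> x" "x < L" "\<phi> x \<noteq> 0" using x y nz by auto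
      have vx: "v x = 0" using v0[of x] x x' nz by force
      let ?D = "(((u x)\<^sup>2 - (v x)\<^sup>2) / 2 + 2 * q x) / (2 * k) / (1 + (u x / (2 * k))\<^sup>2) - k"
      have "((\<lambda>x. arctan (u x / (2 * k)) - k * x) has_field_derivative ?D) (at x)"
      proof -
        have "((\<lambda>x. u x / (2 * k)) has_field_derivative (((u x)\<^sup>2 - (v x)\<^sup>2) / 2 + 2 * q x) / (2 * k)) (at x)"
          by (rule DERIV_cdivide[OF duv(1)[OF x']])
        from DERIV_chain2[OF DERIV_arctan this]
        have "((\<lambda>x. arctan (u x / (2 * k))) has_field_derivative ?D + k) (at x)"
          by (rule DERIV_cong) (simp only: divide_inverse diff_add_cancel mult.commute)
        from DERIV_diff[OF this DERIV_cmult_Id[of k]] show ?thesis by simp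
      qed
      moreover have "?D \<ge> 0"
      proof -
        have "(1 + (u x / (2 * k))\<^sup>2) > 0" by (simp add: add_pos_nonneg)
        moreover have "k * (2 * k * (1 + (u x / (2 * k))\<^sup>2)) = ((u x)\<^sup>2) / 2 + 2 * k\<^sup>2"
          using k by (simp add: field_simps power2_eq_square)
        ultimately have "k \<le> (((u x)\<^sup>2 - (v x)\<^sup>2) / 2 + 2 * q x) / (2 * k) / (1 + (u x / (2 * k))\<^sup>2)"
          using k q[OF x'(1,2)] vx by (simp add: pos_le_divide_eq)
        thus ?thesis by simp
      qed
      ultimately show "\<exists>d. ((\<lambda>x. arctan (u x / (2 * k)) - k * x) has_field_derivative d) (at x) \<and> 0 \<le> d"
        by blast
    qed
    thus ?thesis using init by (simp add: u_def p_def)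
  qed
  have mono: "N 0 \<le> N y"
    if y: "0 \<le> y" "y < L" and nz: "\<And>x. 0 \<le> x \<Longrightarrow> x \<le> y \<Longrightarrow> \<phi> x \<noteq> 0" for y
  proof (rule DERIV_nonneg_imp_nondecreasing[OF y(1)])
    fix x assume x: "0 \<le> x" "x \<le> y"
    have x': "0 \<le> x" "x < L" "\<phi> x \<noteq> 0" using x y nz by auto
    have "k * x \<le> arctan (u x / (2 * k))" using atan[of x] x x' nz by force
    moreover have "0 \<le> k * x" using k x by simp
    ultimately have "0 \<le> arctan (u x / (2 * k))" by linarith
    hence "0 \<le> u x" using k by (simp add: zero_le_divide_iff)
    hence "0 \<le> 2 * u x * N x" by (simp add: N_def)
    thus "\<exists>d. (N has_field_derivative d) (at x) \<and> 0 \<le> d" using dN[OF x'] by blast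
  qed
  have nz: "\<phi> y \<noteq> 0" if y: "0 \<le> y" "y < L" for y
  proof
    assume z: "\<phi> y = 0"
    \<comment> \<open>\<open>Z\<close> is compact, so there is a first zero \<open>x0\<close>. To
      its left \<open>N\<close> stays at least \<open>N 0 > 0\<close>, and continuity carries this
      bound to \<open>x0\<close>.\<close>
    define Z where "Z = {x \<in> {0..y}. \<phi> x = 0}"
    have cont: "continuous_on {0..y} \<phi>"
      using y by (intro continuous_at_imp_continuous_on ballI has_vector_derivative_continuous[OF d\<phi>]) auto
    have "closed Z" unfolding Z_def
      by (intro continuous_closed_preimage_constant cont) auto
    moreover have "bounded Z"
      by (rule bounded_subset[OF bounded_closed_interval[of 0 y]]) (auto simp: Z_def)
    ultimately have "compact Z" by (simp add: compact_eq_bounded_closed)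
    moreover have "Z \<noteq> {}" using z y by (auto simp: Z_def)
    ultimately obtain x0 where x0: "x0 \<in> Z" "\<And>x. x \<in> Z \<Longrightarrow> x0 \<le> x"
      using compact_attains_inf[of Z] by blast
    have x0': "0 < x0" "x0 < L" "\<phi> x0 = 0" using x0(1) init y by (auto simp: Z_def order_less_le)
    have bnd: "N 0 \<le> N x" if "0 \<le> x" "x < x0" for x
    proof (rule mono)
      fix x' assume "0 \<le> x'" "x' \<le> x"
      thus "\<phi> x' \<noteq> 0" using that x0(2)[of x'] x0(1) by (auto simp: Z_def)
    qed (use that x0' in auto)
    have "isCont \<phi> x0" using d\<phi>[of x0] x0' has_vector_derivative_continuous by force
    hence "(N \<longlongrightarrow> N x0) (at_left x0)" unfolding N_def isCont_def
      by (intro tendsto_intros) (rule filterlim_at_split[THEN iffD1, THEN conjunct1])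
    moreover have "eventually (\<lambda>x. N 0 \<le> N x) (at_left x0)"
      using bnd x0'(1) by (auto simp: eventually_at_left intro!: exI[of _ 0])
    ultimately have "N 0 \<le> N x0" by (intro tendsto_lowerbound[of N _ "at_left x0"]) auto
    thus False using x0' init by (simp add: N_def)
  qed
  \<comment> \<open>At \<open>pi / (2 * k)\<close>, which lies before \<open>L\<close>, the
    comparison forces \<open>arctan\<close> to reach \<open>pi / 2\<close>.\<close>
  have "k * (pi / (2 * k)) \<le> arctan (u (pi / (2 * k)) / (2 * k))"
    using k L nz by (intro atan) auto
  thus False using k arctan_ubound[of "u (pi / (2 * k)) / (2 * k)"] by simp
qed

section \<open>Convergence and holomorphy of the Weierstrass series on a rectangular lattice\<close>

lemma summable_int_powr:
  fixes s :: real
  assumes "s < -1"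
  shows "(\<lambda>m::int. (1 + \<bar>real_of_int m\<bar>) powr s) summable_on UNIV"
proof -
  have "summable (\<lambda>n. real (Suc n) powr s)"
    using assms by (subst summable_Suc_iff) (simp add: summable_real_powr_iff)
  hence nat: "(\<lambda>n. (1 + real n) powr s) summable_on UNIV"
    by (subst summable_on_UNIV_nonneg_real_iff) (auto simp: add.commute)
  have "(\<lambda>m::int. (1 + \<bar>real_of_int m\<bar>) powr s) summable_on range int"
    using nat by (subst summable_on_reindex) (auto simp: o_def)
  moreover have "(\<lambda>m::int. (1 + \<bar>real_of_int m\<bar>) powr s) summable_on range (\<lambda>n. - int n)"
    using nat by (subst summable_on_reindex) (auto simp: o_def inj_on_def)
  ultimately have "(\<lambda>m::int. (1 + \<bar>real_of_int m\<bar>) powr s)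
      summable_on (range int \<union> range (\<lambda>n. - int n))"
    by (rule summable_on_union)
  also have "range int \<union> range (\<lambda>n. - int n) = UNIV"
  proof -
    have "m \<in> range int \<union> range (\<lambda>n. - int n)" for m
      by (cases m rule: int_cases2) auto
    thus ?thesis by auto
  qed
  finally show ?thesis .
qed

text \<open>The half-periods are \<open>a\<close> and \<open>\<i> * b\<close>, hence the doubling in
  \<open>\<Lambda>\<close> and \<open>P\<close>. In the main proof they are \<open>omega1 t\<close>
  and \<open>omega2 t\<close>.\<close>

locale rectangular_lattice =
  fixes a b :: real
  assumes a_pos: "a > 0" and b_pos: "b > 0"
begin

definition \<Lambda> :: "complex set" where
  "\<Lambda> = period_lattice (2 * of_real a) (2 * (\<i> * of_real b))"

definition P :: "complex \<Rightarrow> complex" where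
  "P = weierstrass_p (2 * of_real a) (2 * (\<i> * of_real b))"

text \<open>The regular part of \<open>P\<close> at its pole 0. It is split off so that near 0 the
  imaginary part of \<open>P\<close> can be compared with that of
  \<open>1 / z\<^sup>2\<close>.\<close>

definition H :: "complex \<Rightarrow> complex" where
  "H z = (\<Sum>\<^sub>\<infinity>w\<in>\<Lambda> - {0}. 1 / (z - w)\<^sup>2 - 1 / w\<^sup>2)"

text \<open>A box around the rectangle with vertices \<open>0, a, a + \<i> b, \<i> b\<close> on which 0 is the only lattice
  point, with uniform distance to the others.\<close>

definition box\<^sub>0 :: "complex set" where
  "box\<^sub>0 = {z. \<bar>Re z\<bar> \<le> 3 / 2 * a \<and> \<bar>Im z\<bar> \<le> 3 / 2 * b}"

lemma lattice_iff: "w \<in> \<Lambda> \<longleftrightarrow> (\<exists>m n. w = Complex (2 * a * of_int m) (2 * b * of_int n))"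
  unfolding \<Lambda>_def period_lattice_def by (auto simp: complex_eq_iff)

lemma zero_in_lattice: "0 \<in> \<Lambda>"
  unfolding lattice_iff by (rule exI[of _ 0], rule exI[of _ 0]) (simp add: complex_eq_iff)

lemma lattice_uminus: "w \<in> \<Lambda> \<Longrightarrow> - w \<in> \<Lambda>"
proof -
  assume "w \<in> \<Lambda>"
  then obtain m n where "w = Complex (2 * a * of_int m) (2 * b * of_int n)" unfolding lattice_iff by blast
  hence "- w = Complex (2 * a * of_int (- m)) (2 * b * of_int (- n))" by (simp add: complex_eq_iff)
  thus ?thesis unfolding lattice_iff by blast
qed

lemma lattice_cnj: "w \<in> \<Lambda> \<Longrightarrow> cnj w \<in> \<Lambda>"
proof -
  assume "w \<in> \<Lambda>"
  then obtain m n where "w = Complex (2 * a * of_int m) (2 * b * of_int n)" unfolding lattice_iff by blast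
  hence "cnj w = Complex (2 * a * of_int m) (2 * b * of_int (- n))" by (simp add: complex_eq_iff)
  thus ?thesis unfolding lattice_iff by blast
qed

lemma lattice_add: "v \<in> \<Lambda> \<Longrightarrow> w \<in> \<Lambda> \<Longrightarrow> v + w \<in> \<Lambda>"
proof -
  assume "v \<in> \<Lambda>" "w \<in> \<Lambda>"
  then obtain m n m' n' where "v = Complex (2 * a * of_int m) (2 * b * of_int n)"
    "w = Complex (2 * a * of_int m') (2 * b * of_int n')" unfolding lattice_iff by blast
  hence "v + w = Complex (2 * a * of_int (m + m')) (2 * b * of_int (n + n'))"
    by (simp add: complex_eq_iff algebra_simps)
  thus ?thesis unfolding lattice_iff by blast
qed

text \<open>Each of the two coordinates bounds \<open>norm w\<close> from below. Multiplying the two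
  bounds and raising to the power 3/2 bounds \<open>norm w ^ 3\<close> from below by a product of a
  function of \<open>m\<close> and one of \<open>n\<close>. The term at 0 is
  \<open>1 / 0 = 0\<close>.\<close>

lemma summable_inverse_cube: "(\<lambda>w. 1 / norm w ^ 3) summable_on \<Lambda>"
proof -
  define c where "c = min a b"
  have c: "c > 0" "c \<le> a" "c \<le> b" using a_pos b_pos by (auto simp: c_def)
  define e where "e = (\<lambda>(m::int, n::int). Complex (2 * a * of_int m) (2 * b * of_int n))"
  have inj: "inj e" using a_pos b_pos by (auto simp: inj_on_def e_def)
  have im: "e ` UNIV = \<Lambda>" by (force simp: lattice_iff e_def image_iff)
  \<comment> \<open>Half the exponent of the cube, and still below -1, so the majorant is a product
    of two convergent one-dimensional series.\<close>
  define s where "s = (\<lambda>m::int. (1 + \<bar>real_of_int m\<bar>) powr (-3/2))"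
  have s: "s summable_on UNIV" unfolding s_def by (rule summable_int_powr) simp
  hence hs: "(s has_sum infsum s UNIV) UNIV" by simp
  have s_nonneg: "0 \<le> s m" for m by (simp add: s_def)
  have "(\<lambda>(m, n). s m * s n) summable_on UNIV \<times> UNIV"
    by (rule summable_on_SigmaI[where g = "\<lambda>m. s m * infsum s UNIV"])
       (use hs in \<open>auto intro: has_sum_cmult_right summable_on_cmult_left s simp: s_nonneg\<close>)
  hence "(\<lambda>p. 1 / c ^ 3 * (case p of (m, n) \<Rightarrow> s m * s n)) summable_on UNIV"
    by (intro summable_on_cmult_right) simp
  hence "(\<lambda>p. 1 / norm (e p) ^ 3) summable_on UNIV"
  proof (rule summable_on_comparison_test)
    fix p :: "int \<times> int"
    obtain m n where p: "p = (m, n)" by force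
    show "1 / norm (e p) ^ 3 \<le> 1 / c ^ 3 * (case p of (m, n) \<Rightarrow> s m * s n)"
    proof (cases "m = 0 \<and> n = 0")
      case True
      thus ?thesis using c by (auto simp: p e_def s_def norm_complex_def)
    next
      case False
      let ?x = "1 + \<bar>real_of_int m\<bar>" and ?y = "1 + \<bar>real_of_int n\<bar>"
      let ?r = "norm (e p)"
      have "2 * c * \<bar>real_of_int m\<bar> \<le> 2 * a * \<bar>real_of_int m\<bar>" using c by (intro mult_right_mono) auto
      also have "\<dots> = \<bar>Re (e p)\<bar>" using a_pos by (simp add: p e_def abs_mult)
      finally have m: "2 * c * \<bar>real_of_int m\<bar> \<le> ?r" using abs_Re_le_cmod[of "e p"] by linarith
      have "2 * c * \<bar>real_of_int n\<bar> \<le> 2 * b * \<bar>real_of_int n\<bar>" using c by (intro mult_right_mono) auto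
      also have "\<dots> = \<bar>Im (e p)\<bar>" using b_pos by (simp add: p e_def abs_mult)
      finally have n: "2 * c * \<bar>real_of_int n\<bar> \<le> ?r" using abs_Im_le_cmod[of "e p"] by linarith
      have r: "2 * c \<le> ?r"
      proof (cases "m = 0")
        case True
        hence "1 \<le> \<bar>real_of_int n\<bar>" using False by linarith
        hence "2 * c * 1 \<le> 2 * c * \<bar>real_of_int n\<bar>" using c by (intro mult_left_mono) auto
        thus ?thesis using n by linarith
      next
        case False
        hence "1 \<le> \<bar>real_of_int m\<bar>" by linarith
        hence "2 * c * 1 \<le> 2 * c * \<bar>real_of_int m\<bar>" using c by (intro mult_left_mono) auto
        thus ?thesis using m by linarith
      qed
      \<comment> \<open>The averages of \<open>m\<close> with \<open>r\<close> and of
        \<open>n\<close> with \<open>r\<close>.\<close>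
      have xy: "c * ?x \<le> ?r" "c * ?y \<le> ?r" using m n r by (auto simp: algebra_simps)
      have "(c * ?x) * (c * ?y) \<le> ?r * ?r" using xy c by (intro mult_mono) auto
      hence "((c * ?x) * (c * ?y)) powr (3/2) \<le> (?r * ?r) powr (3/2)"
        using c by (intro powr_mono2) auto
      also have "(?r * ?r) powr (3/2) = ?r ^ 3"
        using r c by (simp add: powr_mult flip: powr_add)
      also have "((c * ?x) * (c * ?y)) powr (3/2) = c ^ 3 * (?x powr (3/2) * ?y powr (3/2))"
      proof -
        have "c powr (3/2) * c powr (3/2) = c ^ 3" using c by (simp flip: powr_add)
        thus ?thesis using c by (simp add: powr_mult mult_ac)
      qed
      finally have "c ^ 3 * (?x powr (3/2) * ?y powr (3/2)) \<le> ?r ^ 3" .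
      hence "1 / ?r ^ 3 \<le> 1 / (c ^ 3 * (?x powr (3/2) * ?y powr (3/2)))"
        using c r by (intro divide_left_mono mult_pos_pos) auto
      also have "\<dots> = 1 / c ^ 3 * (case p of (m, n) \<Rightarrow> s m * s n)"
        by (simp add: p s_def powr_minus field_simps)
      finally show ?thesis .
    qed
  qed auto
  hence "(\<lambda>w. 1 / norm w ^ 3) summable_on e ` UNIV"
    using inj by (subst summable_on_reindex) (auto simp: o_def)
  thus ?thesis by (simp add: im)
qed

text \<open>In each coordinate a nonzero entry of \<open>w\<close> is at least twice the half-side,
  while that of \<open>z\<close> is at most 3/2 of it. So \<open>z\<close> cancels at most three
  quarters of \<open>w\<close>, and a quarter remains.\<close>

lemma norm_diff_lattice:
  assumes "z \<in> box\<^sub>0" "w \<in> \<Lambda>"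
  shows "norm w / 4 \<le> norm (z - w)"
proof -
  obtain m n where w: "w = Complex (2 * a * of_int m) (2 * b * of_int n)"
    using assms unfolding lattice_iff by blast
  have *: "\<bar>2 * c * real_of_int k\<bar> / 4 \<le> \<bar>x - 2 * c * real_of_int k\<bar>"
    if "\<bar>x\<bar> \<le> 3 / 2 * c" "c > 0" for x c k
  proof (cases "k = 0")
    case False
    hence "1 \<le> \<bar>real_of_int k\<bar>" by linarith
    hence "c * 1 \<le> c * \<bar>real_of_int k\<bar>" using that by (intro mult_left_mono) auto
    moreover have "\<bar>2 * c * real_of_int k\<bar> = 2 * (c * \<bar>real_of_int k\<bar>)" using that by (simp add: abs_mult)
    ultimately show ?thesis using that by linarith
  qed auto
  have "\<bar>Re (w / 4)\<bar> \<le> \<bar>Re (z - w)\<bar>"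
    using *[of "Re z" a m] assms(1) a_pos by (simp add: w box\<^sub>0_def)
  moreover have "\<bar>Im (w / 4)\<bar> \<le> \<bar>Im (z - w)\<bar>"
    using *[of "Im z" b n] assms(1) b_pos by (simp add: w box\<^sub>0_def)
  ultimately have "norm (w / 4) \<le> norm (z - w)"
    unfolding norm_complex_def by (intro real_sqrt_le_mono add_mono) (simp_all only: abs_le_square_iff)
  thus ?thesis by (simp add: norm_divide)
qed

text \<open>Subtracting \<open>1 / w\<^sup>2\<close> cancels the leading order: the difference is
  \<open>z * (2 * w - z) / ((z - w)\<^sup>2 * w\<^sup>2)\<close>, of order
  \<open>1 / norm w ^ 3\<close> uniformly on the box.\<close>

lemma term_bound: obtains C where "C \<ge> 0"
  "\<And>z w. z \<in> box\<^sub>0 \<Longrightarrow> w \<in> \<Lambda> - {0} \<Longrightarrow> norm (1 / (z - w)\<^sup>2 - 1 / w\<^sup>2) \<le> C * (1 / norm w ^ 3)"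
proof -
  \<comment> \<open>\<open>M\<close> bounds \<open>norm z\<close> on the box, and \<open>d\<close>
    bounds the norms of nonzero lattice points from below, so \<open>M \<le> M / d * norm w\<close>.
    The factor 16 below comes from \<open>(norm w / 4)\<^sup>2\<close>.\<close>
  define M where "M = 3 / 2 * (a + b)"
  define d where "d = 2 * min a b"
  have d: "d > 0" using a_pos b_pos by (auto simp: d_def)
  have M: "M > 0" using a_pos b_pos by (auto simp: M_def)
  show ?thesis
  proof (rule that[of "16 * M * (2 + M / d)"])
    show "16 * M * (2 + M / d) \<ge> 0" using M d by simp
    fix z w assume z: "z \<in> box\<^sub>0" and w: "w \<in> \<Lambda> - {0}"
    have zM: "norm z \<le> M" using cmod_le[of z] z by (auto simp: box\<^sub>0_def M_def)
    have wd: "d \<le> norm w"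
    proof -
      obtain m n where mn: "w = Complex (2 * a * of_int m) (2 * b * of_int n)"
        using w by (auto simp: lattice_iff)
      show ?thesis
      proof (cases "m = 0")
        case True
        hence "n \<noteq> 0" using w mn by (auto simp: complex_eq_iff)
        hence "1 \<le> \<bar>real_of_int n\<bar>" by linarith
        hence "2 * b * 1 \<le> 2 * b * \<bar>real_of_int n\<bar>" using b_pos by (intro mult_left_mono) auto
        also have "\<dots> = \<bar>Im w\<bar>" using b_pos by (simp add: mn abs_mult)
        finally show ?thesis using abs_Im_le_cmod[of w] unfolding d_def by linarith
      next
        case False
        hence "1 \<le> \<bar>real_of_int m\<bar>" by linarith
        hence "2 * a * 1 \<le> 2 * a * \<bar>real_of_int m\<bar>" using a_pos by (intro mult_left_mono) auto
        also have "\<dots> = \<bar>Re w\<bar>" using a_pos by (simp add: mn abs_mult)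
        finally show ?thesis using abs_Re_le_cmod[of w] unfolding d_def by linarith
      qed
    qed
    have nw: "norm w > 0" using w by auto
    have zw: "norm w / 4 \<le> norm (z - w)" using norm_diff_lattice z w by auto
    hence zw0: "norm (z - w) > 0" using nw by linarith
    have "1 / (z - w)\<^sup>2 - 1 / w\<^sup>2 = z * (2 * w - z) / ((z - w)\<^sup>2 * w\<^sup>2)"
      using zw0 nw by (simp add: divide_simps power2_eq_square) (simp add: algebra_simps)
    hence "norm (1 / (z - w)\<^sup>2 - 1 / w\<^sup>2) = norm z * norm (2 * w - z) / ((norm (z - w))\<^sup>2 * (norm w)\<^sup>2)"
      by (simp add: norm_mult norm_divide norm_power)
    also have "\<dots> \<le> M * ((2 + M / d) * norm w) / ((norm w / 4)\<^sup>2 * (norm w)\<^sup>2)"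
    proof (intro frac_le mult_mono power_mono zM zw)
      have "norm (2 * w - z) \<le> 2 * norm w + M" using norm_triangle_ineq4[of "2 * w" z] zM by (simp add: norm_mult)
      also have "M \<le> M / d * norm w" using wd d M by (simp add: field_simps)
      finally show "norm (2 * w - z) \<le> (2 + M / d) * norm w" by (simp add: algebra_simps)
    qed (use M d nw in auto)
    also have "\<dots> = 16 * M * (2 + M / d) * (1 / norm w ^ 3)"
      using nw d by (simp add: power2_eq_square power3_eq_cube divide_simps)
    finally show "norm (1 / (z - w)\<^sup>2 - 1 / w\<^sup>2) \<le> 16 * M * (2 + M / d) * (1 / norm w ^ 3)" .
  qed
qed

lemma summable_majorant: "(\<lambda>w. C * (1 / norm w ^ 3)) summable_on \<Lambda> - {0}"
  by (rule summable_on_cmult_right, rule summable_on_subset_banach[OF summable_inverse_cube]) auto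

text \<open>The index 0 is kept because the lattice symmetries in \<open>P_real\<close> permute all
  of \<open>\<Lambda>\<close> and may move 0.\<close>

lemma summable_terms:
  assumes "z \<in> box\<^sub>0"
  shows "(\<lambda>w. 1 / (z - w)\<^sup>2 - 1 / w\<^sup>2) summable_on \<Lambda>"
proof -
  obtain C where C: "\<And>z w. z \<in> box\<^sub>0 \<Longrightarrow> w \<in> \<Lambda> - {0} \<Longrightarrow>
      norm (1 / (z - w)\<^sup>2 - 1 / w\<^sup>2) \<le> C * (1 / norm w ^ 3)" using term_bound by metis
  have "(\<lambda>w. 1 / (z - w)\<^sup>2 - 1 / w\<^sup>2) summable_on (\<Lambda> - {0})"
    by (rule abs_summable_summable, rule Infinite_Sum.abs_summable_on_comparison_test'[OF summable_majorant[of C]])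
       (use assms C in auto)
  hence "(\<lambda>w. 1 / (z - w)\<^sup>2 - 1 / w\<^sup>2) summable_on insert 0 (\<Lambda> - {0})"
    by (simp only: summable_on_insert_iff)
  thus ?thesis using zero_in_lattice by (simp add: insert_absorb)
qed

lemma P_eq: "P z = 1 / z\<^sup>2 + H z"
  by (simp add: P_def weierstrass_p_def H_def \<Lambda>_def)

text \<open>Since \<open>1 / 0 = 0\<close>, the term of \<open>w = 0\<close> is the principal part.\<close>

lemma P_eq_infsum:
  assumes "z \<in> box\<^sub>0"
  shows "P z = (\<Sum>\<^sub>\<infinity>w\<in>\<Lambda>. 1 / (z - w)\<^sup>2 - 1 / w\<^sup>2)"
proof -
  have "(\<lambda>w. 1 / (z - w)\<^sup>2 - 1 / w\<^sup>2) summable_on (\<Lambda> - {0})"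
    by (rule summable_on_subset_banach[OF summable_terms[OF assms]]) auto
  hence "(\<Sum>\<^sub>\<infinity>w\<in>insert 0 (\<Lambda> - {0}). 1 / (z - w)\<^sup>2 - 1 / w\<^sup>2) = 1 / z\<^sup>2 + H z"
    unfolding H_def by (subst infsum_insert) auto
  thus ?thesis using zero_in_lattice by (simp add: insert_absorb P_eq)
qed

text \<open>The majorant does not depend on \<open>z\<close>, so the M-test gives uniform
  convergence of the finite partial sums on small disks, and holomorphy passes to the limit.\<close>

lemma H_holomorphic: "H holomorphic_on interior box\<^sub>0"
proof (rule holomorphic_on_open[THEN iffD2, OF open_interior], rule ballI)
  fix z assume "z \<in> interior box\<^sub>0"
  then obtain r where r: "r > 0" "cball z r \<subseteq> box\<^sub>0"
    by (meson mem_interior_cball)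
  obtain C where C: "\<And>z w. z \<in> box\<^sub>0 \<Longrightarrow> w \<in> \<Lambda> - {0} \<Longrightarrow>
      norm (1 / (z - w)\<^sup>2 - 1 / w\<^sup>2) \<le> C * (1 / norm w ^ 3)" using term_bound by metis
  have lim: "uniform_limit (cball z r) (\<lambda>X z. \<Sum>w\<in>X. 1 / (z - w)\<^sup>2 - 1 / w\<^sup>2) H
      (finite_subsets_at_top (\<Lambda> - {0}))"
    unfolding H_def
    by (rule Weierstrass_m_test_general[where M = "\<lambda>w. C * (1 / norm w ^ 3)"])
       (use r C summable_majorant in auto)
  have hol: "(\<lambda>z. \<Sum>w\<in>X. 1 / (z - w)\<^sup>2 - 1 / w\<^sup>2) holomorphic_on cball z r" if "X \<subseteq> \<Lambda> - {0}" for X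
  proof (intro holomorphic_intros)
    fix z' w assume "z' \<in> cball z r" "w \<in> X"
    hence "z' \<in> box\<^sub>0" "w \<in> \<Lambda>" "w \<noteq> 0" using that r by auto
    with norm_diff_lattice[of z' w] have "norm w / 4 \<le> norm (z' - w)" "w \<noteq> 0" by auto
    thus "(z' - w)\<^sup>2 \<noteq> 0" by auto
  qed
  have "\<forall>\<^sub>F X in finite_subsets_at_top (\<Lambda> - {0}).
      continuous_on (cball z r) (\<lambda>z. \<Sum>w\<in>X. 1 / (z - w)\<^sup>2 - 1 / w\<^sup>2) \<and>
      (\<lambda>z. \<Sum>w\<in>X. 1 / (z - w)\<^sup>2 - 1 / w\<^sup>2) holomorphic_on ball z r"
    by (rule eventually_finite_subsets_at_top_weakI)
       (auto intro!: holomorphic_on_imp_continuous_on hol holomorphic_on_subset[OF hol])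
  from holomorphic_uniform_limit[OF this lim] have "H holomorphic_on ball z r" by auto
  thus "\<exists>f'. (H has_field_derivative f') (at z)"
    using r by (auto simp: holomorphic_on_open)
qed

lemma interior_box: "z \<in> interior box\<^sub>0" if "\<bar>Re z\<bar> < 3 / 2 * a" "\<bar>Im z\<bar> < 3 / 2 * b"
proof (rule interiorI)
  show "open {z. \<bar>Re z\<bar> < 3 / 2 * a \<and> \<bar>Im z\<bar> < 3 / 2 * b}"
    by (intro open_Collect_conj open_Collect_less continuous_intros)
qed (use that in \<open>auto simp: box\<^sub>0_def\<close>)

lemma H_0: "H 0 = 0"
  by (simp add: H_def)

section \<open>Reality and sign of \<open>P\<close> on the half-period rectangle\<close>

text \<open>The map \<open>w \<mapsto> \<epsilon> * cnj w + w\<^sub>0\<close> preserves the lattice and, by the assumption on \<open>z\<close>, conjugates the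
  terms \<open>(z - w)\<^sup>2\<close>. The terms \<open>1 / w\<^sup>2\<close> that make the series converge are not preserved,
  but the total error is the sum \<open>T\<close>, which changes sign under \<open>w \<mapsto> - (w + \<epsilon> * w\<^sub>0)\<close>.\<close>

lemma P_real:
  assumes z: "z \<in> box\<^sub>0" and eps: "\<epsilon> = 1 \<or> \<epsilon> = (-1 :: complex)" and w0: "w\<^sub>0 \<in> \<Lambda>"
    and refl: "z = \<epsilon> * cnj z + w\<^sub>0"
  shows "Im (P z) = 0"
proof -
  define f where "f = (\<lambda>w. 1 / (z - w)\<^sup>2 - 1 / w\<^sup>2)"
  define \<sigma> where "\<sigma> = (\<lambda>w. \<epsilon> * cnj w + w\<^sub>0)"
  have ee: "\<epsilon> * \<epsilon> = 1" "cnj \<epsilon> = \<epsilon>" using eps by auto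
  have mem: "\<epsilon> * w \<in> \<Lambda>" if "w \<in> \<Lambda>" for w using eps that lattice_uminus[of w] by auto
  have \<sigma>: "\<sigma> w \<in> \<Lambda>" if "w \<in> \<Lambda>" for w
    unfolding \<sigma>_def using that w0 by (intro lattice_add mem lattice_cnj)
  \<comment> \<open>Reflecting \<open>z\<close> twice returns \<open>z\<close>, so the translation
    part of the squared reflection vanishes. Hence \<open>\<sigma>\<close> is an involution.\<close>
  have w0': "\<epsilon> * cnj w\<^sub>0 + w\<^sub>0 = 0"
  proof -
    have "cnj z = \<epsilon> * z + cnj w\<^sub>0" using refl ee by (metis complex_cnj_add complex_cnj_cnj complex_cnj_mult)
    hence "z = \<epsilon> * (\<epsilon> * z + cnj w\<^sub>0) + w\<^sub>0" using refl by simp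
    hence "z = (\<epsilon> * \<epsilon>) * z + (\<epsilon> * cnj w\<^sub>0 + w\<^sub>0)" by (simp add: algebra_simps)
    thus ?thesis by (simp add: ee)
  qed
  have \<sigma>\<sigma>: "\<sigma> (\<sigma> w) = w" for w
  proof -
    have "\<sigma> (\<sigma> w) = (\<epsilon> * \<epsilon>) * w + (\<epsilon> * cnj w\<^sub>0 + w\<^sub>0)" by (simp add: \<sigma>_def ee algebra_simps)
    thus ?thesis by (simp add: ee w0')
  qed
  have f: "f summable_on \<Lambda>" unfolding f_def by (rule summable_terms[OF z])
  have bij: "bij_betw \<sigma> \<Lambda> \<Lambda>"
    by (rule bij_betwI[of _ _ _ \<sigma>]) (auto simp: \<sigma> \<sigma>\<sigma>)
  have P1: "P z = infsum f \<Lambda>" by (simp add: P_eq_infsum[OF z] f_def)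
  also have "\<dots> = (\<Sum>\<^sub>\<infinity>w\<in>\<Lambda>. f (\<sigma> w))" by (rule infsum_reindex_bij_betw[OF bij, symmetric])
  finally have P2: "P z = (\<Sum>\<^sub>\<infinity>w\<in>\<Lambda>. f (\<sigma> w))" .
  have f\<sigma>: "(\<lambda>w. f (\<sigma> w)) summable_on \<Lambda>" using f by (subst summable_on_reindex_bij_betw[OF bij])
  have fc: "(\<lambda>w. cnj (f w)) summable_on \<Lambda>" using f by simp
  have diff: "f (\<sigma> w) - cnj (f w) = 1 / (cnj w)\<^sup>2 - 1 / (\<epsilon> * cnj w + w\<^sub>0)\<^sup>2" for w
  proof -
    have "z - \<sigma> w = \<epsilon> * cnj (z - w)" using refl by (simp add: \<sigma>_def algebra_simps)
    hence "(z - \<sigma> w)\<^sup>2 = (\<epsilon> * \<epsilon>) * (cnj (z - w))\<^sup>2" by (simp add: power2_eq_square)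
    hence "(z - \<sigma> w)\<^sup>2 = (cnj (z - w))\<^sup>2" by (simp add: ee)
    thus ?thesis by (simp add: f_def \<sigma>_def)
  qed
  define T where "T = (\<Sum>\<^sub>\<infinity>w\<in>\<Lambda>. 1 / w\<^sup>2 - 1 / (\<epsilon> * w + w\<^sub>0)\<^sup>2)"
  have "P z - cnj (P z) = (\<Sum>\<^sub>\<infinity>w\<in>\<Lambda>. f (\<sigma> w)) + - (\<Sum>\<^sub>\<infinity>w\<in>\<Lambda>. cnj (f w))"
    using P1 P2 by simp
  also have "\<dots> = (\<Sum>\<^sub>\<infinity>w\<in>\<Lambda>. f (\<sigma> w) + - cnj (f w))"
    using infsum_add[OF f\<sigma>, of "\<lambda>w. - cnj (f w)"] fc
    by (simp only: infsum_uminus summable_on_uminus)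
  also have "\<dots> = (\<Sum>\<^sub>\<infinity>w\<in>\<Lambda>. 1 / (cnj w)\<^sup>2 - 1 / (\<epsilon> * cnj w + w\<^sub>0)\<^sup>2)"
    by (simp add: diff[symmetric])
  also have "\<dots> = T" unfolding T_def
    by (rule infsum_reindex_bij_betw[of cnj \<Lambda> \<Lambda> "\<lambda>w. 1 / w\<^sup>2 - 1 / (\<epsilon> * w + w\<^sub>0)\<^sup>2"])
       (rule bij_betwI[of _ _ _ cnj], auto simp: lattice_cnj)
  also have "T = - T"
  proof -
    define \<tau> where "\<tau> = (\<lambda>w. - (w + \<epsilon> * w\<^sub>0))"
    have \<tau>: "\<tau> w \<in> \<Lambda>" if "w \<in> \<Lambda>" for w
      unfolding \<tau>_def using that w0 by (intro lattice_add lattice_uminus mem)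
    have "T = (\<Sum>\<^sub>\<infinity>w\<in>\<Lambda>. 1 / (\<tau> w)\<^sup>2 - 1 / (\<epsilon> * \<tau> w + w\<^sub>0)\<^sup>2)" unfolding T_def
      by (rule infsum_reindex_bij_betw[of \<tau> \<Lambda> \<Lambda> "\<lambda>w. 1 / w\<^sup>2 - 1 / (\<epsilon> * w + w\<^sub>0)\<^sup>2", symmetric])
         (rule bij_betwI[of _ _ _ \<tau>], auto simp: \<tau>, auto simp: \<tau>_def)
    also have "\<dots> = (\<Sum>\<^sub>\<infinity>w\<in>\<Lambda>. - (1 / w\<^sup>2 - 1 / (\<epsilon> * w + w\<^sub>0)\<^sup>2))"
    proof (rule infsum_cong)
      fix w
      have "(\<tau> w)\<^sup>2 = (\<epsilon> * w + w\<^sub>0)\<^sup>2" "(\<epsilon> * \<tau> w + w\<^sub>0)\<^sup>2 = w\<^sup>2"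
        using eps by (auto simp: \<tau>_def power2_eq_square algebra_simps)
      thus "1 / (\<tau> w)\<^sup>2 - 1 / (\<epsilon> * \<tau> w + w\<^sub>0)\<^sup>2 = - (1 / w\<^sup>2 - 1 / (\<epsilon> * w + w\<^sub>0)\<^sup>2)" by simp
    qed
    also have "\<dots> = - T" unfolding T_def by (rule infsum_uminus)
    finally show ?thesis .
  qed
  finally have "P z - cnj (P z) = - T" .
  moreover have "T = 0" using \<open>T = - T\<close> by simp
  ultimately have "P z - cnj (P z) = - 0" by (simp only:)
  hence "Im (P z - cnj (P z)) = Im (- 0)" by (rule arg_cong)
  thus ?thesis by simp
qed

lemma P_real_sides:
  assumes z: "0 \<le> Re z" "Re z \<le> a" "0 \<le> Im z" "Im z \<le> b"
    and side: "Re z = 0 \<or> Re z = a \<or> Im z = 0 \<or> Im z = b"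
  shows "Im (P z) = 0"
proof -
  have box: "z \<in> box\<^sub>0" using z a_pos b_pos by (auto simp: box\<^sub>0_def)
  \<comment> \<open>The sides through 0 are fixed by reflections with \<open>w\<^sub>0 = 0\<close>;
    on the opposite sides \<open>w\<^sub>0\<close> is a full period.\<close>
  have per_a: "complex_of_real (2 * a) \<in> \<Lambda>"
    unfolding lattice_iff by (rule exI[of _ 1], rule exI[of _ 0]) (simp add: complex_eq_iff)
  have per_b: "\<i> * complex_of_real (2 * b) \<in> \<Lambda>"
    unfolding lattice_iff by (rule exI[of _ 0], rule exI[of _ 1]) (simp add: complex_eq_iff)
  from side consider "Re z = 0" | "Re z = a" | "Im z = 0" | "Im z = b" by blast
  thus ?thesis
  proof cases
    case 1
    thus ?thesis by (intro P_real[OF box, of "-1" 0]) (auto simp: zero_in_lattice complex_eq_iff)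
  next
    case 2
    thus ?thesis using per_a
      by (intro P_real[OF box, of "-1" "of_real (2 * a)"]) (auto simp: complex_eq_iff)
  next
    case 3
    thus ?thesis by (intro P_real[OF box, of "1" 0]) (auto simp: zero_in_lattice complex_eq_iff)
  next
    case 4
    thus ?thesis using per_b
      by (intro P_real[OF box, of "1" "\<i> * of_real (2 * b)"]) (auto simp: complex_eq_iff)
  qed
qed

lemma P_holomorphic: "P holomorphic_on interior box\<^sub>0 - {0}"
proof -
  have "(\<lambda>z. 1 / z\<^sup>2 + H z) holomorphic_on interior box\<^sub>0 - {0}"
    by (intro holomorphic_intros holomorphic_on_subset[OF H_holomorphic]) auto
  thus ?thesis by (simp add: P_eq[abs_def])
qed

text \<open>Maximum principle for the harmonic function \<open>Im P\<close>: it vanishes on the sides, and near the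
  pole at 0 it is dominated by \<open>Im (1 / z\<^sup>2) \<le> 0\<close>.\<close>

lemma Im_P_nonpos:
  assumes z: "0 \<le> Re z" "Re z \<le> a" "0 \<le> Im z" "Im z \<le> b" "z \<noteq> 0"
  shows "Im (P z) \<le> 0"
proof (rule field_le_epsilon)
  fix \<delta> :: real assume \<delta>: "\<delta> > 0"
  have "isCont H 0"
    using H_holomorphic interior_box[of 0] a_pos b_pos
    by (auto intro!: continuous_on_interior holomorphic_on_imp_continuous_on simp: interior_interior)
  then obtain r where r: "r > 0" "\<And>w. dist w 0 < r \<Longrightarrow> dist (H w) (H 0) < \<delta>"
    using \<delta> unfolding continuous_at_eps_delta by metis
  \<comment> \<open>Below \<open>r\<close>, so that \<open>H\<close> is small on the arc of radius
    \<open>e\<close>, and at most \<open>norm z\<close>, so that cutting out the pole leaves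
    \<open>z\<close> in \<open>S\<close>.\<close>
  define e where "e = min (norm z) (r / 2)"
  have e: "e > 0" "e < r" "e \<le> norm z" using r z by (auto simp: e_def)
  define S where "S = {w. 0 \<le> Re w \<and> Re w \<le> a \<and> 0 \<le> Im w \<and> Im w \<le> b \<and> e \<le> norm w}"
  have clS: "closed S" unfolding S_def by (intro closed_Collect_conj closed_Collect_le continuous_intros)
  have sub: "S \<subseteq> interior box\<^sub>0 - {0}" using e a_pos b_pos interior_box by (auto simp: S_def)
  have bS: "bounded S"
  proof (rule boundedI)
    fix w assume "w \<in> S"
    thus "norm w \<le> a + b" using cmod_le[of w] by (auto simp: S_def)
  qed
  \<comment> \<open>\<open>norm (exp (- \<i> * P w)) = exp (Im (P w))\<close>, so the maximum
    modulus principle bounds \<open>Im P\<close>.\<close>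
  have hol: "(\<lambda>w. exp (- \<i> * P w)) holomorphic_on S"
    by (intro holomorphic_intros holomorphic_on_subset[OF P_holomorphic sub])
  have "norm (exp (- \<i> * P z)) \<le> exp \<delta>"
  proof (rule maximum_modulus_frontier[where S = S and f = "\<lambda>w. exp (- \<i> * P w)"])
    show "(\<lambda>w. exp (- \<i> * P w)) holomorphic_on interior S"
      by (rule holomorphic_on_subset[OF hol interior_subset])
    show "continuous_on (closure S) (\<lambda>w. exp (- \<i> * P w))"
      using holomorphic_on_imp_continuous_on[OF hol] clS by simp
    show "bounded S" by (rule bS)
    show "z \<in> S" using z e by (auto simp: S_def)
    fix w assume "w \<in> frontier S"
    hence wS: "w \<in> S" "w \<notin> interior S" using clS by (auto simp: frontier_def)
    have "Im (P w) \<le> \<delta>"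
    proof (cases "Re w = 0 \<or> Re w = a \<or> Im w = 0 \<or> Im w = b")
      case True
      thus ?thesis using P_real_sides[of w] wS \<delta> by (auto simp: S_def)
    next
      case False
      \<comment> \<open>A frontier point off the four sides lies on the arc around the pole.\<close>
      have "norm w = e"
      proof (rule ccontr)
        assume "norm w \<noteq> e"
        have "w \<in> interior S"
        proof (rule interiorI)
          show "open {w. 0 < Re w \<and> Re w < a \<and> 0 < Im w \<and> Im w < b \<and> e < norm w}"
            by (intro open_Collect_conj open_Collect_less continuous_intros)
          show "{w. 0 < Re w \<and> Re w < a \<and> 0 < Im w \<and> Im w < b \<and> e < norm w} \<subseteq> S"
            unfolding S_def by (intro Collect_mono) simp
          show "w \<in> {w. 0 < Re w \<and> Re w < a \<and> 0 < Im w \<and> Im w < b \<and> e < norm w}"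
            using wS(1) False \<open>norm w \<noteq> e\<close> by (simp add: S_def less_le)
        qed
        thus False using wS by simp
      qed
      hence "norm (H w) < \<delta>" using r(2)[of w] e by (simp add: H_0)
      hence "Im (H w) \<le> \<delta>" using abs_Im_le_cmod[of "H w"] by linarith
      moreover have "Im (1 / w\<^sup>2) \<le> 0"
      proof -
        have "0 \<le> Im (w\<^sup>2)" using wS by (simp add: S_def power2_eq_square)
        thus ?thesis by (simp add: Im_divide divide_nonpos_nonneg)
      qed
      ultimately show ?thesis by (simp add: P_eq)
    qed
    thus "norm (exp (- \<i> * P w)) \<le> exp \<delta>" by simp
  qed
  thus "Im (P z) \<le> 0 + \<delta>" by simp
qed

section \<open>Monotonicity of \<open>P\<close> along the top and right sides\<close>

lemma P_deriv:
  assumes "0 \<le> Re z" "Re z \<le> a" "0 \<le> Im z" "Im z \<le> b" "z \<noteq> 0"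
  shows "(P has_field_derivative deriv P z) (at z)"
proof -
  have "z \<in> interior box\<^sub>0 - {0}" using assms a_pos b_pos by (auto intro!: interior_box)
  thus ?thesis using holomorphic_derivI[OF P_holomorphic] by (auto simp: open_delete)
qed

text \<open>One complex derivative \<open>D\<close> serves both the direction \<open>1\<close> and
  the direction \<open>\<i>\<close>; \<open>Im (\<i> * D) = Re D\<close> and
  \<open>Re (\<i> * D) = - Im D\<close> then act as the Cauchy-Riemann equations.\<close>

lemma P_line_deriv:
  fixes c d :: complex
  assumes "(P has_field_derivative D) (at (c + d * of_real x))"
  shows "((\<lambda>x. Re (P (c + d * of_real x))) has_field_derivative Re (d * D)) (at x)"
    "((\<lambda>x. Im (P (c + d * of_real x))) has_field_derivative Im (d * D)) (at x)"
proof -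
  have "((\<lambda>x. c + d * of_real x) has_vector_derivative d) (at x)"
    by (auto intro!: derivative_eq_intros)
  from field_vector_diff_chain_at[OF this assms]
  have "((\<lambda>x. P (c + d * of_real x)) has_vector_derivative d * D) (at x)" by (simp add: o_def)
  thus "((\<lambda>x. Re (P (c + d * of_real x))) has_field_derivative Re (d * D)) (at x)"
    "((\<lambda>x. Im (P (c + d * of_real x))) has_field_derivative Im (d * D)) (at x)"
    by (simp_all add: has_vector_derivative_complex_iff)
qed

text \<open>As \<open>Im P\<close> is nonpositive inside and vanishes on the sides, its normal derivative has a sign
  there; by the Cauchy-Riemann equations this is the tangential derivative of \<open>Re P\<close>.\<close>

lemma Re_P_top_mono:
  assumes "0 \<le> x" "x \<le> y" "y \<le> a"
  shows "Re (P (Complex x b)) \<le> Re (P (Complex y b))"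
proof (rule DERIV_nonneg_imp_nondecreasing[OF assms(2)])
  fix s assume "x \<le> s" "s \<le> y"
  hence s: "0 \<le> s" "s \<le> a" using assms by auto
  define D where "D = deriv P (Complex s b)"
  have D: "(P has_field_derivative D) (at (Complex s b))"
    unfolding D_def using s b_pos by (intro P_deriv) (auto simp: complex_eq_iff)
  have 1: "\<i> * of_real b + 1 * of_real s = Complex s b" "of_real s + \<i> * of_real b = Complex s b"
    by (auto simp: complex_eq_iff)
  have "((\<lambda>x. Re (P (\<i> * of_real b + 1 * of_real x))) has_field_derivative Re (1 * D)) (at s)"
    by (rule P_line_deriv) (use D 1 in simp)
  moreover have "\<i> * of_real b + 1 * of_real x = Complex x b" for x by (auto simp: complex_eq_iff)
  ultimately have "((\<lambda>x. Re (P (Complex x b))) has_field_derivative Re D) (at s)" by simp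
  moreover have "Re D \<ge> 0"
  proof (rule ccontr)
    assume "\<not> Re D \<ge> 0"
    have "((\<lambda>x. Im (P (of_real s + \<i> * of_real x))) has_field_derivative Im (\<i> * D)) (at b)"
      by (rule P_line_deriv) (use D 1 in simp)
    \<comment> \<open>A negative derivative towards the side would make \<open>Im P\<close> larger
      just below the side than on it, where it is 0.\<close>
    from DERIV_neg_dec_left[OF this] \<open>\<not> Re D \<ge> 0\<close> obtain d where d: "d > 0"
      "\<And>h. h > 0 \<Longrightarrow> h < d \<Longrightarrow> Im (P (of_real s + \<i> * of_real b)) < Im (P (of_real s + \<i> * of_real (b - h)))"
      by auto
    define h where "h = min (d / 2) (b / 2)"
    have h: "h > 0" "h < d" "h < b" using d b_pos by (auto simp: h_def)
    have "Im (P (of_real s + \<i> * of_real b)) = 0"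
      using s b_pos by (intro P_real_sides) auto
    moreover have "Im (P (of_real s + \<i> * of_real (b - h))) \<le> 0"
      using s b_pos h by (intro Im_P_nonpos) (auto simp: complex_eq_iff)
    ultimately show False using d(2)[OF h(1,2)] by linarith
  qed
  ultimately show "\<exists>d. ((\<lambda>x. Re (P (Complex x b))) has_field_derivative d) (at s) \<and> 0 \<le> d" by blast
qed

text \<open>The same argument for the vertical side. The tangential derivative of
  \<open>Re P\<close> is \<open>Re (\<i> * D) = - Im D\<close>, while the outward derivative of
  \<open>Im P\<close> is \<open>Im D\<close>; this sign makes \<open>Re P\<close> decrease
  upwards.\<close>

lemma Re_P_right_antimono:
  assumes "0 \<le> x" "x \<le> y" "y \<le> b"
  shows "Re (P (Complex a y)) \<le> Re (P (Complex a x))"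
proof (rule DERIV_nonpos_imp_nonincreasing[OF assms(2)])
  fix s assume "x \<le> s" "s \<le> y"
  hence s: "0 \<le> s" "s \<le> b" using assms by auto
  define D where "D = deriv P (Complex a s)"
  have D: "(P has_field_derivative D) (at (Complex a s))"
    unfolding D_def using s a_pos by (intro P_deriv) (auto simp: complex_eq_iff)
  have 1: "of_real a + \<i> * of_real s = Complex a s" "\<i> * of_real s + 1 * of_real a = Complex a s"
    by (auto simp: complex_eq_iff)
  have "((\<lambda>x. Re (P (of_real a + \<i> * of_real x))) has_field_derivative Re (\<i> * D)) (at s)"
    by (rule P_line_deriv) (use D 1 in simp)
  moreover have "of_real a + \<i> * of_real x = Complex a x" for x by (auto simp: complex_eq_iff)
  ultimately have "((\<lambda>x. Re (P (Complex a x))) has_field_derivative - Im D) (at s)" by simp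
  moreover have "Im D \<ge> 0"
  proof (rule ccontr)
    assume "\<not> Im D \<ge> 0"
    have "((\<lambda>x. Im (P (\<i> * of_real s + 1 * of_real x))) has_field_derivative Im (1 * D)) (at a)"
      by (rule P_line_deriv) (use D 1 in simp)
    from DERIV_neg_dec_left[OF this] \<open>\<not> Im D \<ge> 0\<close> obtain d where d: "d > 0"
      "\<And>h. h > 0 \<Longrightarrow> h < d \<Longrightarrow> Im (P (\<i> * of_real s + 1 * of_real a)) < Im (P (\<i> * of_real s + 1 * of_real (a - h)))"
      by auto
    define h where "h = min (d / 2) (a / 2)"
    have h: "h > 0" "h < d" "h < a" using d a_pos by (auto simp: h_def)
    have "Im (P (\<i> * of_real s + 1 * of_real a)) = 0"
      using s a_pos by (intro P_real_sides) auto
    moreover have "Im (P (\<i> * of_real s + 1 * of_real (a - h))) \<le> 0"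
      using s a_pos h by (intro Im_P_nonpos) (auto simp: complex_eq_iff)
    ultimately show False using d(2)[OF h(1,2)] by linarith
  qed
  ultimately show "\<exists>d. ((\<lambda>x. Re (P (Complex a x))) has_field_derivative d) (at s) \<and> d \<le> 0"
    by force
qed

end

section \<open>The map \<open>E\<close> on the half-axes\<close>

text \<open>The integrand of \<open>E\<close> on a half-axis, with \<open>\<kappa>\<close> equal to
  \<open>cos (2 * t)\<close> on the real axis and to its negative on the imaginary axis.\<close>

definition speed :: "real \<Rightarrow> real \<Rightarrow> real" where
  "speed \<kappa> s = 1 / sqrt (s ^ 4 - 2 * \<kappa> * s\<^sup>2 + 1)"

lemma speed_radicand_pos: "\<bar>\<kappa>\<bar> < 1 \<Longrightarrow> 0 < s ^ 4 - 2 * \<kappa> * s\<^sup>2 + (1 :: real)"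
proof -
  assume "\<bar>\<kappa>\<bar> < 1"
  hence "\<kappa>\<^sup>2 < 1" by (simp add: abs_square_less_1)
  moreover have "s ^ 4 - 2 * \<kappa> * s\<^sup>2 + 1 = (s\<^sup>2 - \<kappa>)\<^sup>2 + (1 - \<kappa>\<^sup>2)"
    by (simp add: power2_eq_square power4_eq_xxxx algebra_simps)
  moreover have "0 \<le> (s\<^sup>2 - \<kappa>)\<^sup>2" by simp
  ultimately show ?thesis by linarith
qed

lemma speed_pos: "\<bar>\<kappa>\<bar> < 1 \<Longrightarrow> 0 < speed \<kappa> s"
  using speed_radicand_pos[of \<kappa> s] by (simp add: speed_def)

lemma speed_continuous: "\<bar>\<kappa>\<bar> < 1 \<Longrightarrow> continuous_on A (speed \<kappa>)"
proof -
  assume "\<bar>\<kappa>\<bar> < 1"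
  hence "s ^ 4 - 2 * \<kappa> * s\<^sup>2 + 1 \<noteq> 0" for s using speed_radicand_pos[of \<kappa> s] by simp
  thus ?thesis unfolding speed_def by (intro continuous_intros) auto
qed

definition arclen :: "real \<Rightarrow> real \<Rightarrow> real" where
  "arclen \<kappa> r = integral {0..r} (speed \<kappa>)"

lemma arclen_deriv:
  assumes "\<bar>\<kappa>\<bar> < 1" "r \<in> {0..1}"
  shows "(arclen \<kappa> has_vector_derivative speed \<kappa> r) (at r within {0..1})"
  unfolding arclen_def[abs_def]
  by (rule integral_has_vector_derivative[OF speed_continuous]) (use assms in auto)

lemma arclen_0 [simp]: "arclen \<kappa> 0 = 0"
  by (simp add: arclen_def)

lemma arclen_1_pos:
  assumes "\<bar>\<kappa>\<bar> < 1"
  shows "0 < arclen \<kappa> 1"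
proof -
  have "integral {0..1} (speed \<kappa>) \<noteq> 0"
  proof
    assume "integral {0..1} (speed \<kappa>) = 0"
    hence "speed \<kappa> 0 = 0"
      using integral_eq_0_iff[OF speed_continuous[OF assms], of 0 1] speed_pos[OF assms]
      by (auto simp: less_imp_le)
    thus False using speed_pos[OF assms, of 0] by simp
  qed
  moreover have "integral {0..1} (speed \<kappa>) \<ge> 0"
    by (intro integral_nonneg integrable_continuous_interval speed_continuous assms)
       (use speed_pos[OF assms] in \<open>auto intro: less_imp_le\<close>)
  ultimately show ?thesis by (simp add: arclen_def)
qed

text \<open>Along the half-axis with direction \<open>d\<close>, the polynomial is \<open>s ^ 4 - 2 * \<kappa> * s\<^sup>2 + 1\<close> with
  \<open>\<kappa> = cos (2 * t) * d\<^sup>2\<close>.\<close>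

lemma E_on_axis:
  fixes \<delta> :: real
  assumes \<kappa>: "\<bar>\<kappa>\<bar> < 1" and d: "d\<^sup>2 = of_real \<delta>" "\<delta>\<^sup>2 = 1" "\<kappa> = cos (2 * t) * \<delta>" and r: "0 \<le> r" "r \<le> 1"
  shows "E t (d * of_real r) = d * of_real (arclen \<kappa> r)"
proof -
  let ?f = "\<lambda>u. 1 / csqrt (u ^ 4 - 2 * complex_of_real (cos (2 * t)) * u\<^sup>2 + 1)"
  have f: "?f (d * of_real s) = of_real (speed \<kappa> s)" for s
  proof -
    have "(d * of_real s) ^ 4 = (d\<^sup>2)\<^sup>2 * of_real s ^ 4"
      by (simp add: power_mult_distrib flip: power_mult)
    also have "\<dots> = of_real (s ^ 4)" using d(2) by (simp add: d(1) flip: of_real_power)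
    finally have rad: "(d * of_real s) ^ 4 - 2 * complex_of_real (cos (2 * t)) * (d * of_real s)\<^sup>2 + 1
        = of_real (s ^ 4 - 2 * \<kappa> * s\<^sup>2 + 1)"
      by (simp add: power_mult_distrib d(1,3))
    have "csqrt (of_real (s ^ 4 - 2 * \<kappa> * s\<^sup>2 + 1)) = of_real (sqrt (s ^ 4 - 2 * \<kappa> * s\<^sup>2 + 1))"
      using speed_radicand_pos[OF \<kappa>, of s] by (intro of_real_sqrt[symmetric]) simp
    thus ?thesis by (simp only: rad speed_def of_real_divide of_real_1)
  qed
  \<comment> \<open>Up to the factor \<open>d\<close>, this is an antiderivative of the integrand
    pulled back along the segment from 0 to \<open>d * r\<close>.\<close>
  have "((\<lambda>x. arclen \<kappa> (r * x)) has_vector_derivative r * speed \<kappa> (r * x)) (at x within {0..1})"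
    if "x \<in> {0..1}" for x
  proof -
    have rx: "r * y \<in> {0..1}" if "y \<in> {0..1}" for y using that r by (auto intro: mult_le_one)
    have "((\<lambda>x. r * x) has_vector_derivative r) (at x within {0..1})"
      by (auto intro!: derivative_eq_intros)
    moreover have "(arclen \<kappa> has_vector_derivative speed \<kappa> (r * x)) (at (r * x) within (\<lambda>x. r * x) ` {0..1})"
      by (rule has_vector_derivative_within_subset[OF arclen_deriv[OF \<kappa> rx[OF that]]])
         (intro image_subsetI rx)
    ultimately have "((arclen \<kappa> \<circ> (\<lambda>x. r * x)) has_vector_derivative r *\<^sub>R speed \<kappa> (r * x)) (at x within {0..1})"
      by (rule vector_diff_chain_within)
    thus ?thesis by (simp add: o_def)
  qed
  hence "((\<lambda>x. r * speed \<kappa> (r * x)) has_integral arclen \<kappa> (r * 1) - arclen \<kappa> (r * 0)) {0..1}"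
    by (intro fundamental_theorem_of_calculus) auto
  from has_integral_of_real[OF this, where 'b = complex]
  have "((\<lambda>x. of_real (r * speed \<kappa> (r * x)) :: complex) has_integral of_real (arclen \<kappa> r)) {0..1}"
    by simp
  hence "((\<lambda>x. d * of_real (r * speed \<kappa> (r * x))) has_integral d * of_real (arclen \<kappa> r)) {0..1}"
    by (rule has_integral_mult_right)
  moreover have "?f (linepath 0 (d * of_real r) x) * (d * of_real r - 0) = d * of_real (r * speed \<kappa> (r * x))" for x
  proof -
    have "linepath 0 (d * of_real r) x = d * of_real (r * x)"
      by (simp add: linepath_def scaleR_conv_of_real mult_ac)
    thus ?thesis by (simp only: f) simp
  qed
  ultimately have "(?f has_contour_integral d * of_real (arclen \<kappa> r)) (linepath 0 (d * of_real r))"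
    unfolding has_contour_integral_linepath by presburger
  thus ?thesis unfolding E_def by (rule contour_integral_unique)
qed

text \<open>\<open>E\<close> moves the point at distance \<open>r\<close> on the half-axis to
  distance \<open>arclen \<kappa> r\<close>, and by the intermediate value theorem every
  \<open>s\<close> below \<open>arclen \<kappa> 1\<close> is reached. As \<open>s\<close> is
  strictly below, \<open>r < 1\<close> and the preimage is in the open disk.\<close>

lemma axis_in_R:
  fixes \<delta> :: real
  assumes \<kappa>: "\<bar>\<kappa>\<bar> < 1" and d: "d\<^sup>2 = of_real \<delta>" "\<delta>\<^sup>2 = 1" "\<kappa> = cos (2 * t) * \<delta>"
    and s: "0 \<le> s" "s < arclen \<kappa> 1"
  shows "d * of_real s \<in> R t"
proof -
  have "continuous_on {0..1} (arclen \<kappa>)"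
    unfolding continuous_on_eq_continuous_within
    by (intro ballI has_vector_derivative_continuous[OF arclen_deriv[OF \<kappa>]])
  then obtain r where r: "0 \<le> r" "r \<le> 1" "arclen \<kappa> r = s"
    using IVT'[of "arclen \<kappa>" 0 s 1] s by auto
  hence "r < 1" using s by (cases "r = 1") auto
  have "(norm d)\<^sup>2 = \<bar>\<delta>\<bar>" by (simp add: d(1) flip: norm_power)
  also have "\<dots> = 1" using d(2) unfolding power2_eq_1_iff by auto
  finally have "norm d = 1" unfolding power2_eq_1_iff using norm_ge_zero[of d] by linarith
  hence "d * of_real r \<in> ball 0 1" using r \<open>r < 1\<close> by (simp add: norm_mult)
  moreover have "E t (d * of_real r) = d * of_real s" using E_on_axis[OF \<kappa> d r(1,2)] r by simp
  ultimately show ?thesis unfolding R_def by (metis imageI)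
qed

section \<open>From a pole-free \<open>g\<close> to bounds on \<open>\<mu>\<close>\<close>

text \<open>Restricted to a line with \<open>d\<^sup>2 = \<delta> = \<plusminus>1\<close>, the Schwarzian equation is a Riccati equation for
  \<open>d * g'' / g'\<close>.\<close>

lemma pole_free_bound:
  fixes \<delta> k L :: real and d :: complex and q :: "real \<Rightarrow> real"
  assumes g: "is_g \<alpha> t \<mu> g" and np: "\<And>z. z \<in> R t \<Longrightarrow> \<not> is_pole g z"
    and d: "d\<^sup>2 = of_real \<delta>" and R: "\<And>s. 0 \<le> s \<Longrightarrow> s < L \<Longrightarrow> d * of_real s \<in> R t"
    and eq: "\<And>s. 0 \<le> s \<Longrightarrow> s < L \<Longrightarrow>
      of_real \<delta> * (complex_of_real ((1 - 4 * \<alpha>\<^sup>2) / 2) * wp t (d * of_real s + omega3 t) - 2 * complex_of_real \<mu>)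
        = of_real (2 * q s)"
    and q: "\<And>s. 0 \<le> s \<Longrightarrow> s < L \<Longrightarrow> k\<^sup>2 \<le> q s"
    and k: "0 \<le> k" and L: "0 < L"
  shows "k \<le> pi / (2 * L)"
proof (rule ccontr)
  assume "\<not> k \<le> pi / (2 * L)"
  hence kL: "pi / (2 * L) < k" by simp
  have "0 < pi / (2 * L)" using L by simp
  hence k0: "k > 0" using kL by linarith
  \<comment> \<open>The blow-up point lies inside the segment.\<close>
  have kL': "pi / (2 * k) < L" using kL k0 L by (simp add: field_simps)
  have g': "g nicely_meromorphic_on R t" "deriv g 0 = 1" "deriv (deriv g) 0 = 0"
    using g unfolding is_g_def by blast+
  \<comment> \<open>Now \<open>\<phi>' / \<phi>\<close> is \<open>d * g'' / g'\<close>. The Riccati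
    equation is claimed only where \<open>g'\<close> is nonzero; \<open>riccati_blowup\<close>
    itself rules out zeros on the segment.\<close>
  define \<phi> where "\<phi> = (\<lambda>s. deriv g (d * of_real s))"
  define \<phi>' where "\<phi>' = (\<lambda>s. d * deriv (deriv g) (d * of_real s))"
  have line: "((\<lambda>s. d * of_real s) has_vector_derivative d) (at s)" for s
    by (auto intro!: derivative_eq_intros)
  have an: "deriv g analytic_on {d * of_real s}" "deriv (deriv g) analytic_on {d * of_real s}"
    if "0 \<le> s" "s < L" for s
  proof -
    have "g analytic_on {d * of_real s}"
      using np R[OF that] by (intro nicely_meromorphic_on_imp_analytic_at[OF g'(1)]) auto
    thus "deriv g analytic_on {d * of_real s}" "deriv (deriv g) analytic_on {d * of_real s}"
      by (intro analytic_deriv; assumption)+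
  qed
  show False
  proof (rule riccati_blowup[OF k0 kL', of \<phi> \<phi>' q])
    fix s assume s: "0 \<le> s" "s < L"
    have "(deriv g has_field_derivative deriv (deriv g) (d * of_real s)) (at (d * of_real s))"
      using an(1)[OF s] by (intro DERIV_deriv_iff_field_differentiable[THEN iffD2] analytic_on_imp_differentiable_at) auto
    from field_vector_diff_chain_at[OF line this]
    show "(\<phi> has_vector_derivative \<phi>' s) (at s)" by (simp add: \<phi>_def \<phi>'_def o_def)
  next
    fix s assume s: "0 \<le> s" "s < L" and nz: "\<phi> s \<noteq> 0"
    define z where "z = d * of_real s"
    define Q where "Q = (\<lambda>w. deriv (deriv g) w / deriv g w)"
    have "Q analytic_on {z}"
      unfolding Q_def z_def by (rule analytic_on_divide[OF an(2,1)[OF s]]) (use nz in \<open>auto simp: \<phi>_def\<close>)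
    hence "(Q has_field_derivative deriv Q z) (at z)"
      by (intro DERIV_deriv_iff_field_differentiable[THEN iffD2] analytic_on_imp_differentiable_at) auto
    from field_vector_diff_chain_at[OF line this[unfolded z_def]]
    have "((\<lambda>s. Q (d * of_real s)) has_vector_derivative d * deriv Q z) (at s)"
      by (simp add: o_def z_def)
    from has_vector_derivative_mult_right[OF this, of d]
    have "((\<lambda>s. \<phi>' s / \<phi> s) has_vector_derivative d\<^sup>2 * deriv Q z) (at s)"
      by (simp add: \<phi>_def \<phi>'_def Q_def power2_eq_square mult.assoc)
    moreover have "d\<^sup>2 * deriv Q z = (\<phi>' s / \<phi> s)\<^sup>2 / 2 + of_real (2 * q s)"
    proof -
      have "schwarzian g z = complex_of_real ((1 - 4 * \<alpha>\<^sup>2) / 2) * wp t (z + omega3 t) - 2 * complex_of_real \<mu>"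
        using g R[OF s] np[OF R[OF s]] unfolding is_g_def z_def by blast
      moreover have "schwarzian g z = deriv Q z - 1 / 2 * (Q z)\<^sup>2"
        by (simp add: schwarzian_def Q_def)
      ultimately have "d\<^sup>2 * (deriv Q z - 1 / 2 * (Q z)\<^sup>2) = of_real (2 * q s)"
        using eq[OF s] by (simp only: d z_def)
      moreover have "\<phi>' s / \<phi> s = d * Q z" by (simp add: \<phi>_def \<phi>'_def Q_def z_def)
      ultimately show ?thesis by (simp add: power_mult_distrib algebra_simps)
    qed
    ultimately show "((\<lambda>x. \<phi>' x / \<phi> x) has_vector_derivative (\<phi>' s / \<phi> s)\<^sup>2 / 2 + of_real (2 * q s)) (at s)"
      by simp
  next
    show "\<phi> 0 \<noteq> 0" "\<phi>' 0 = 0" using g'(2,3) by (simp_all add: \<phi>_def \<phi>'_def)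
  next
    fix s assume "0 \<le> s" "s < L"
    thus "k\<^sup>2 \<le> q s" by (rule q)
  qed
qed

theorem proposition4p2:
  fixes \<alpha> t :: real
  assumes "0 \<le> \<alpha>" and "\<alpha> \<le> 2" and "0 < t" and "t < pi / 2"
  shows "(\<alpha> \<le> 1 / 2 \<longrightarrow>
            ereal ((1 / 4 - \<alpha>\<^sup>2) * e2 t - (pi / (2 * Re (omega1 t)))\<^sup>2) \<le> mu_min \<alpha> t \<and>
            mu_max \<alpha> t \<le> ereal ((1 / 4 - \<alpha>\<^sup>2) * e1 t + (pi / (2 * cmod (omega2 t)))\<^sup>2)) \<and>
         (\<alpha> \<ge> 1 / 2 \<longrightarrow>
            ereal ((1 / 4 - \<alpha>\<^sup>2) * e3 t - (pi / (2 * Re (omega1 t)))\<^sup>2) \<le> mu_min \<alpha> t \<and>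
            mu_max \<alpha> t \<le> ereal ((1 / 4 - \<alpha>\<^sup>2) * e3 t + (pi / (2 * cmod (omega2 t)))\<^sup>2))"
proof -
  define \<kappa> where "\<kappa> = cos (2 * t)"
  have \<kappa>: "\<bar>\<kappa>\<bar> < 1" "\<bar>- \<kappa>\<bar> < 1"
    using cos_monotone_0_pi[of 0 "2 * t"] cos_monotone_0_pi[of "2 * t" pi] assms by (auto simp: \<kappa>_def)
  define a where "a = arclen \<kappa> 1"
  define b where "b = arclen (- \<kappa>) 1"
  have ab: "a > 0" "b > 0" using arclen_1_pos \<kappa> by (auto simp: a_def b_def)
  have lat: "rectangular_lattice a b" by (rule rectangular_lattice.intro) (fact ab)+
  define P where "P = rectangular_lattice.P a b"
  have o1: "omega1 t = of_real a"
    using E_on_axis[OF \<kappa>(1), of 1 1 t 1] by (simp add: omega1_def a_def \<kappa>_def)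
  have o2: "omega2 t = \<i> * of_real b"
    using E_on_axis[OF \<kappa>(2), of \<i> "-1" t 1] by (simp add: omega2_def b_def \<kappa>_def)
  have o3: "omega3 t = Complex a b"
    by (simp add: omega3_def o1 o2 complex_eq_iff)
  have wp: "wp t = P" by (simp add: wp_def P_def rectangular_lattice.P_def[OF lat] o1 o2)
  \<comment> \<open>Moving from 0 in the directions \<open>-1\<close> and \<open>- \<i>\<close>
    makes the argument shifted by \<open>omega3 t\<close> run from the corner
    \<open>Complex a b\<close> along the top side and down the right side.\<close>
  have Ra: "(-1) * of_real s \<in> R t" if "0 \<le> s" "s < a" for s
    using that by (intro axis_in_R[OF \<kappa>(1), of _ 1]) (auto simp: \<kappa>_def a_def)
  have Rb: "(- \<i>) * of_real s \<in> R t" if "0 \<le> s" "s < b" for s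
    using that by (intro axis_in_R[OF \<kappa>(2), of _ "-1"]) (auto simp: \<kappa>_def b_def)
  have e1: "e1 t = Re (P (Complex a 0))"
    by (simp add: e1_def wp o1 complex_of_real_def)
  have e2: "e2 t = Re (P (Complex 0 b))"
    by (simp add: e2_def wp o2 Complex_eq)
  have e3: "e3 t = Re (P (Complex a b))"
    by (simp add: e3_def wp o3)
  define c where "c = 1 / 4 - \<alpha>\<^sup>2"
  have c2: "(1 - 4 * \<alpha>\<^sup>2) / 2 = 2 * c" by (simp add: c_def)
  \<comment> \<open>Here \<open>\<delta> = 1\<close>, so \<open>q = c * P - \<mu>\<close> on the top
    side, and \<open>k\<close> is the root of its lower bound \<open>c * m - \<mu>\<close>. If that
    bound is negative, the claim is immediate.\<close>
  have lower: "c * m - (pi / (2 * a))\<^sup>2 \<le> \<mu>"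
    if \<mu>: "\<mu> \<in> pole_free_params \<alpha> t" and m: "\<And>x. 0 \<le> x \<Longrightarrow> x \<le> a \<Longrightarrow> c * m \<le> c * Re (P (Complex x b))" for \<mu> m
  proof (cases "c * m - \<mu> \<ge> 0")
    case True
    obtain g where g: "is_g \<alpha> t \<mu> g" "\<And>z. z \<in> R t \<Longrightarrow> \<not> is_pole g z"
      using \<mu> by (auto simp: pole_free_params_def)
    have "sqrt (c * m - \<mu>) \<le> pi / (2 * a)"
    proof (rule pole_free_bound[OF g, of "-1" 1 a "\<lambda>s. c * Re (P (Complex (a - s) b)) - \<mu>"])
      fix s assume s: "0 \<le> s" "s < a"
      have arg: "- 1 * of_real s + omega3 t = Complex (a - s) b" by (simp add: o3 complex_eq_iff)
      define X where "X = Re (P (Complex (a - s) b))"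
      have PX: "P (Complex (a - s) b) = of_real X" unfolding X_def
        using rectangular_lattice.P_real_sides[OF lat, of "Complex (a - s) b", folded P_def] s ab
        by (simp add: complex_eq_iff)
      show "of_real 1 * (complex_of_real ((1 - 4 * \<alpha>\<^sup>2) / 2) * wp t (- 1 * of_real s + omega3 t)
          - 2 * complex_of_real \<mu>) = of_real (2 * (c * Re (P (Complex (a - s) b)) - \<mu>))"
        unfolding c2 wp arg PX by simp
      show "(sqrt (c * m - \<mu>))\<^sup>2 \<le> c * Re (P (Complex (a - s) b)) - \<mu>"
        using m[of "a - s"] s True by simp
    qed (use Ra True ab in auto)
    hence "(sqrt (c * m - \<mu>))\<^sup>2 \<le> (pi / (2 * a))\<^sup>2" using True by (intro power_mono) auto
    thus ?thesis using True by simp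
  next
    case False
    moreover have "0 \<le> (pi / (2 * a))\<^sup>2" by simp
    ultimately show ?thesis by linarith
  qed
  \<comment> \<open>The direction \<open>- \<i>\<close> has square -1, which reverses the sign:
    \<open>q = \<mu> - c * P\<close> on the right side, of length \<open>b\<close>.\<close>
  have upper: "\<mu> \<le> c * m + (pi / (2 * b))\<^sup>2"
    if \<mu>: "\<mu> \<in> pole_free_params \<alpha> t" and m: "\<And>y. 0 \<le> y \<Longrightarrow> y \<le> b \<Longrightarrow> c * Re (P (Complex a y)) \<le> c * m" for \<mu> m
  proof (cases "\<mu> - c * m \<ge> 0")
    case True
    obtain g where g: "is_g \<alpha> t \<mu> g" "\<And>z. z \<in> R t \<Longrightarrow> \<not> is_pole g z"
      using \<mu> by (auto simp: pole_free_params_def)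
    have "sqrt (\<mu> - c * m) \<le> pi / (2 * b)"
    proof (rule pole_free_bound[OF g, of "- \<i>" "-1" b "\<lambda>s. \<mu> - c * Re (P (Complex a (b - s)))"])
      fix s assume s: "0 \<le> s" "s < b"
      have arg: "- \<i> * of_real s + omega3 t = Complex a (b - s)" by (simp add: o3 complex_eq_iff)
      define X where "X = Re (P (Complex a (b - s)))"
      have PX: "P (Complex a (b - s)) = of_real X" unfolding X_def
        using rectangular_lattice.P_real_sides[OF lat, of "Complex a (b - s)", folded P_def] s ab
        by (simp add: complex_eq_iff)
      show "of_real (-1) * (complex_of_real ((1 - 4 * \<alpha>\<^sup>2) / 2) * wp t (- \<i> * of_real s + omega3 t)
          - 2 * complex_of_real \<mu>) = of_real (2 * (\<mu> - c * Re (P (Complex a (b - s)))))"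
        unfolding c2 wp arg PX by simp
      show "(sqrt (\<mu> - c * m))\<^sup>2 \<le> \<mu> - c * Re (P (Complex a (b - s)))"
        using m[of "b - s"] s True by simp
    qed (use Rb True ab in auto)
    hence "(sqrt (\<mu> - c * m))\<^sup>2 \<le> (pi / (2 * b))\<^sup>2" using True by (intro power_mono) auto
    thus ?thesis using True by simp
  next
    case False
    moreover have "0 \<le> (pi / (2 * b))\<^sup>2" by simp
    ultimately show ?thesis by linarith
  qed
  \<comment> \<open>The corner value \<open>m\<close> enters only through \<open>c * m\<close>, so
    that both signs of \<open>c\<close> are covered.\<close>
  have mu_min: "ereal (c * m - (pi / (2 * a))\<^sup>2) \<le> mu_min \<alpha> t"
    if "\<And>x. 0 \<le> x \<Longrightarrow> x \<le> a \<Longrightarrow> c * m \<le> c * Re (P (Complex x b))" for m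
    unfolding mu_min_def using lower[OF _ that] by (intro INF_greatest) simp
  have mu_max: "mu_max \<alpha> t \<le> ereal (c * m + (pi / (2 * b))\<^sup>2)"
    if "\<And>y. 0 \<le> y \<Longrightarrow> y \<le> b \<Longrightarrow> c * Re (P (Complex a y)) \<le> c * m" for m
    unfolding mu_max_def using upper[OF _ that] by (intro SUP_least) simp
  have top: "e2 t \<le> Re (P (Complex x b))" "Re (P (Complex x b)) \<le> e3 t" if "0 \<le> x" "x \<le> a" for x
    unfolding e2 e3 using that rectangular_lattice.Re_P_top_mono[OF lat, folded P_def] by auto
  have right: "e3 t \<le> Re (P (Complex a y))" "Re (P (Complex a y)) \<le> e1 t" if "0 \<le> y" "y \<le> b" for y
    unfolding e1 e3 using that rectangular_lattice.Re_P_right_antimono[OF lat, folded P_def] by auto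
  have norms: "Re (omega1 t) = a" "cmod (omega2 t) = b" using ab by (simp_all add: o1 o2 norm_mult)
  show ?thesis unfolding norms c_def[symmetric]
  \<comment> \<open>For \<open>c \<ge> 0\<close> the extreme corners are \<open>e2\<close> on the
    top side and \<open>e1\<close> on the right side. For \<open>c \<le> 0\<close> multiplication
    reverses the order, and both become the common corner \<open>e3\<close>.\<close>
  proof (intro conjI impI)
    assume "\<alpha> \<le> 1 / 2"
    hence "\<alpha>\<^sup>2 \<le> (1 / 2)\<^sup>2" using assms(1) by (intro power_mono)
    hence c: "c \<ge> 0" by (simp add: c_def power2_eq_square)
    show "ereal (c * e2 t - (pi / (2 * a))\<^sup>2) \<le> mu_min \<alpha> t"
      using c top by (intro mu_min mult_left_mono)
    show "mu_max \<alpha> t \<le> ereal (c * e1 t + (pi / (2 * b))\<^sup>2)"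
      using c right by (intro mu_max mult_left_mono)
  next
    assume "1 / 2 \<le> \<alpha>"
    hence "(1 / 2)\<^sup>2 \<le> \<alpha>\<^sup>2" by (intro power_mono) auto
    hence c: "c \<le> 0" by (simp add: c_def power2_eq_square)
    show "ereal (c * e3 t - (pi / (2 * a))\<^sup>2) \<le> mu_min \<alpha> t"
      using c top by (intro mu_min mult_left_mono_neg)
    show "mu_max \<alpha> t \<le> ereal (c * e3 t + (pi / (2 * b))\<^sup>2)"
      using c right by (intro mu_max mult_left_mono_neg)
  qed
qed

end
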